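(* There exist constants $\alpha,\epsilon>0$ such that for every positive integer $n$ there is an $\lfloor\alpha n\rfloor$-dimensional topological subsphere $X$ of $S^n$ such that $X_\epsilon$ contains no linear subsphere of dimension $1$.
   Context: $S^n$ is the Euclidean unit sphere of $\mathbb{R}^{n+1}$. An $m$-dimensional topological subsphere of $S^n$ is the image of a continuous function $f:S^m\to S^n$ that preserves antipodal points, i.e. $f(-x)=-f(x)$ for all $x\in S^m$. A linear subsphere of dimension $d$ of $S^n$ is the unit sphere $V\cap S^n$ of a $(d+1)$-dimensional linear subspace $V$ of $\mathbb{R}^{n+1}$ (so a linear subsphere of dimension $1$ is a great circle). For $A\subset S^n$ and $\epsilon>0$, $A_\epsilon$ is the $\epsilon$-expansion of $A$: the set of all points of $S^n$ at (Euclidean) distance at most $\epsilon$ from $A$. *)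

theory Defs
  imports "HOL-Analysis.Analysis" "HOL-Library.Function_Algebras"
begin

text \<open>
  The dimension n varies inside the theorem, so R^n is not a type here but the carrier
  \<^term>\<open>topspace (Euclidean_space n)\<close>: the functions of type \<^typ>\<open>nat \<Rightarrow> real\<close> vanishing at all
  indices from \<^term>\<open>n\<close> on. The sphere S^n in R^(n+1) is \<^const>\<open>nsphere\<close>. The pointwise vector
  space structure gives access to \<^const>\<open>subspace\<close> and \<^const>\<open>dim\<close>.
\<close>

instantiation "fun" :: (type, real_vector) real_vector
begin

definition scaleR_fun :: "real \<Rightarrow> ('a \<Rightarrow> 'b) \<Rightarrow> 'a \<Rightarrow> 'b"
  where "scaleR_fun c f = (\<lambda>x. c *\<^sub>R f x)"

instance
  by standard (simp_all add: scaleR_fun_def fun_eq_iff scaleR_add_right scaleR_add_left)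

end

definition topological_subsphere :: "nat \<Rightarrow> nat \<Rightarrow> (nat \<Rightarrow> real) set \<Rightarrow> bool"
  where "topological_subsphere m n X \<longleftrightarrow>
    (\<exists>f. continuous_map (nsphere m) (nsphere n) f \<and>
         (\<forall>x\<in>topspace (nsphere m). f (- x) = - f x) \<and>
         X = f ` topspace (nsphere m))"

definition linear_subsphere :: "nat \<Rightarrow> nat \<Rightarrow> (nat \<Rightarrow> real) set \<Rightarrow> bool"
  where "linear_subsphere d n L \<longleftrightarrow>
    (\<exists>V. subspace V \<and> V \<subseteq> topspace (Euclidean_space (Suc n)) \<and> dim V = Suc d \<and>
         L = V \<inter> topspace (nsphere n))"

text \<open>
  The overloaded \<^const>\<open>dist\<close> on \<^typ>\<open>nat \<Rightarrow> real\<close> is a different (bounded) product metric,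
  so the Euclidean distance has to be written out.
\<close>

definition euclidean_dist :: "nat \<Rightarrow> (nat \<Rightarrow> real) \<Rightarrow> (nat \<Rightarrow> real) \<Rightarrow> real"
  where "euclidean_dist n x y = L2_set (\<lambda>i. x i - y i) {..<n}"

text \<open>
  The distance from a point to a set is the infimum of the distances to its points; the
  expansion of the empty set is empty (the infimum over it is unspecified).
\<close>

definition expansion :: "nat \<Rightarrow> real \<Rightarrow> (nat \<Rightarrow> real) set \<Rightarrow> (nat \<Rightarrow> real) set"
  where "expansion n \<epsilon> A =
    {x \<in> topspace (nsphere n). A \<noteq> {} \<and> (INF a\<in>A. euclidean_dist (Suc n) x a) \<le> \<epsilon>}"

end

theory Submission
  imports Defs
begin

text \<open>
  Every great circle passes through a vector of small l1 norm: averaging over the three vectors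
  at angles 0, 60 and -60 degrees gives at most (2 sqrt 2 / 3) sqrt N, where N = n + 1. It
  therefore suffices to find an odd map whose values all have l1 norm close to sqrt N. As in the
  Hobby--Rice theorem, a point x of the k-sphere cuts the unit interval into k + 1 intervals of
  lengths x i ^ 2 carrying the signs of x i; averaging this step function over the N intervals
  [j/N, (j+1)/N] gives a vector with entries in [-1, 1] of which at most k differ from 1 and -1,
  so that after normalisation its l1 norm is at least (1 - k/N) sqrt N.
\<close>

subsection \<open>The step-function map\<close>

text \<open>For \<open>N > 0\<close> this is \<open>N\<close> times the length of the part of cell
  \<open>j\<close>, the interval [j/N, (j+1)/N], that lies to the left of \<open>t\<close>. A
  difference of two ramps is therefore the average over that cell of the indicator function of an
  interval.\<close>

definition ramp :: "nat \<Rightarrow> nat \<Rightarrow> real \<Rightarrow> real"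
  where "ramp N j t = max 0 (min 1 (real N * t - real j))"

text \<open>The breakpoints of the partition: interval \<open>i\<close> runs from
  \<open>cut x i\<close> to \<open>cut x (Suc i)\<close>.\<close>

definition cut :: "(nat \<Rightarrow> real) \<Rightarrow> nat \<Rightarrow> real"
  where "cut x i = (\<Sum>l<i. (x l)\<^sup>2)"

text \<open>
  Each summand is \<^term>\<open>sgn (x i) * (ramp N j (cut x (Suc i)) - ramp N j (cut x i))\<close>, written in
  a form that is visibly continuous in \<^term>\<open>x\<close>.
\<close>

definition step_average :: "nat \<Rightarrow> nat \<Rightarrow> nat \<Rightarrow> (nat \<Rightarrow> real) \<Rightarrow> real"
  where "step_average N k j x =
    (\<Sum>i<k. ramp N j (cut x i + (max (x i) 0)\<^sup>2) - ramp N j (cut x i + (min (x i) 0)\<^sup>2))"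

lemma ramp_mono: "s \<le> t \<Longrightarrow> ramp N j s \<le> ramp N j t"
proof -
  assume "s \<le> t"
  then have "real N * s \<le> real N * t"
    by (simp add: mult_left_mono)
  then show ?thesis
    unfolding ramp_def by linarith
qed

lemma ramp_bounds: "0 \<le> ramp N j t" "ramp N j t \<le> 1"
  by (auto simp: ramp_def)

lemma ramp_0: "ramp N j 0 = 0"
  by (simp add: ramp_def)

lemma ramp_1: "j < N \<Longrightarrow> ramp N j 1 = 1"
  by (auto simp: ramp_def)

text \<open>A value strictly between 0 and 1 puts \<open>real N * t\<close> strictly between
  \<open>j\<close> and \<open>j + 1\<close>. So each breakpoint spoils at most one cell.\<close>

lemma ramp_zero_one:
  assumes "j \<noteq> nat \<lfloor>real N * t\<rfloor>"
  shows "ramp N j t = 0 \<or> ramp N j t = 1"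
proof (rule ccontr)
  assume "\<not> ?thesis"
  then have "real j < real N * t" "real N * t < real j + 1"
    by (auto simp: ramp_def max_def min_def split: if_splits)
  then have "\<lfloor>real N * t\<rfloor> = int j"
    by (intro floor_unique) auto
  with assms show False
    by simp
qed

lemma cut_simps: "cut x 0 = 0" "cut x (Suc i) = cut x i + (x i)\<^sup>2"
  by (simp_all add: cut_def)

lemma cut_last:
  assumes "x \<in> topspace (nsphere k)"
  shows "cut x (Suc k) = 1"
  using assms by (simp add: nsphere cut_def lessThan_Suc_atMost)

text \<open>Whatever the sign of \<open>x k\<close>, at least one of the two clipped squares
  vanishes; this recovers the sign form, on which the estimates below rest.\<close>

lemma step_average_Suc:
  "step_average N (Suc k) j x =
    step_average N k j x + sgn (x k) * (ramp N j (cut x (Suc k)) - ramp N j (cut x k))"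
  by (simp add: step_average_def cut_simps max_def min_def sgn_if)

lemma step_average_0: "step_average N 0 j x = 0"
  by (simp add: step_average_def)

lemma step_average_minus: "step_average N k j (- x) = - step_average N k j x"
proof -
  have "cut (- x) i = cut x i" for i
    by (simp add: cut_def)
  then show ?thesis
    by (induction k) (simp_all add: step_average_0 step_average_Suc sgn_minus)
qed

text \<open>The breakpoints increase, so the ramp increments are nonnegative and telescope once the
  signs are dropped.\<close>

lemma abs_step_average_le_ramp: "\<bar>step_average N k j x\<bar> \<le> ramp N j (cut x k)"
proof (induction k)
  case 0
  then show ?case
    by (simp add: step_average_0 ramp_bounds)
next
  case (Suc k)
  have "ramp N j (cut x k) \<le> ramp N j (cut x (Suc k))"
    by (rule ramp_mono) (simp add: cut_simps)
  then have "\<bar>sgn (x k) * (ramp N j (cut x (Suc k)) - ramp N j (cut x k))\<bar>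
      \<le> ramp N j (cut x (Suc k)) - ramp N j (cut x k)"
    by (simp add: abs_mult sgn_if)
  then show ?case
    using Suc unfolding step_average_Suc by linarith
qed

lemma abs_step_average_le_1: "\<bar>step_average N k j x\<bar> \<le> 1"
  using abs_step_average_le_ramp ramp_bounds(2) by (rule order_trans)

text \<open>A monotone sequence of zeros and ones jumps at most once, so at most one summand is
  nonzero and the signs cannot cause cancellation.\<close>

lemma abs_step_average_eq_ramp:
  assumes "\<And>i. i \<le> k \<Longrightarrow> ramp N j (cut x i) = 0 \<or> ramp N j (cut x i) = 1"
  shows "\<bar>step_average N k j x\<bar> = ramp N j (cut x k)"
  using assms
proof (induction k)
  case 0
  then show ?case
    by (simp add: step_average_0 cut_simps ramp_0)
next
  case (Suc k)
  have IH: "\<bar>step_average N k j x\<bar> = ramp N j (cut x k)"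
    using Suc by simp
  have mono: "ramp N j (cut x k) \<le> ramp N j (cut x (Suc k))"
    by (rule ramp_mono) (simp add: cut_simps)
  have same: "x k = 0 \<Longrightarrow> ramp N j (cut x (Suc k)) = ramp N j (cut x k)"
    by (simp add: cut_simps)
  show ?case
    using IH mono same Suc.prems[of k] Suc.prems[of "Suc k"]
    by (auto simp: step_average_Suc sgn_if)
qed

lemma sum_abs_step_average_ge:
  assumes x: "x \<in> topspace (nsphere k)"
  shows "real N - real k \<le> (\<Sum>j<N. \<bar>step_average N (Suc k) j x\<bar>)"
proof -
  \<comment> \<open>The cells spoiled by interior breakpoints. The end breakpoints 0 and 1 are left
    out: there every ramp with \<open>j < N\<close> is exactly 0 or 1.\<close>
  define B where "B = (\<lambda>i. nat \<lfloor>real N * cut x i\<rfloor>) ` {1..k}"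
  have one: "\<bar>step_average N (Suc k) j x\<bar> = 1" if j: "j \<in> {..<N} - B" for j
  proof -
    have "ramp N j (cut x i) = 0 \<or> ramp N j (cut x i) = 1" if "i \<le> Suc k" for i
    proof -
      consider "i = 0" | "i = Suc k" | "i \<in> {1..k}"
        using \<open>i \<le> Suc k\<close> by force
      then show ?thesis
      proof cases
        case 1
        then show ?thesis by (simp add: cut_simps ramp_0)
      next
        case 2
        then show ?thesis using j cut_last[OF x] by (simp add: ramp_1)
      next
        case 3
        then show ?thesis using j by (intro ramp_zero_one) (auto simp: B_def)
      qed
    qed
    then have "\<bar>step_average N (Suc k) j x\<bar> = ramp N j (cut x (Suc k))"
      by (rule abs_step_average_eq_ramp)
    then show ?thesis
      using j cut_last[OF x] by (simp add: ramp_1)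
  qed
  have "card B \<le> k"
    unfolding B_def using card_image_le[of "{1..k}"] by force
  moreover have "N - card B \<le> card ({..<N} - B)"
    using diff_card_le_card_Diff[of B "{..<N}"] by (simp add: B_def)
  ultimately have "real N - real k \<le> real (card ({..<N} - B))"
    by linarith
  also have "\<dots> = (\<Sum>j\<in>{..<N} - B. \<bar>step_average N (Suc k) j x\<bar>)"
    using one by simp
  also have "\<dots> \<le> (\<Sum>j<N. \<bar>step_average N (Suc k) j x\<bar>)"
    by (rule sum_mono2) auto
  finally show ?thesis .
qed

lemma continuous_map_ramp [continuous_intros]:
  "continuous_map X euclideanreal f \<Longrightarrow> continuous_map X euclideanreal (\<lambda>x. ramp N j (f x))"
  unfolding ramp_def by (intro continuous_intros) auto

lemma continuous_map_step_average:
  "continuous_map (nsphere k) euclideanreal (step_average N m j)"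
  unfolding step_average_def cut_def
  by (intro continuous_intros continuous_map_nsphere_projection) auto

subsection \<open>Norms on spheres\<close>

lemma in_nsphere_iff:
  "x \<in> topspace (nsphere n) \<longleftrightarrow> L2_set x {..<Suc n} = 1 \<and> (\<forall>i>n. x i = 0)"
  by (simp add: nsphere L2_set_def lessThan_Suc_atMost)

lemma sum_abs_le_L2_set:
  "(\<Sum>i<N. \<bar>f i\<bar>) \<le> sqrt (real N) * L2_set f {..<N}" for f :: "nat \<Rightarrow> real"
  using L2_set_mult_ineq[of f "\<lambda>_. 1" "{..<N}"] by (simp add: L2_set_constant mult.commute)

text \<open>The vector of step averages has l1 norm at least \<open>N - k\<close>, and Euclidean
  norm at most \<open>sqrt N\<close> because its entries lie in [-1, 1]. Normalising it gives the
  quotient of these bounds.\<close>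

lemma ex_odd_map_large_l1_norm:
  assumes "k \<le> n"
  shows "\<exists>f. continuous_map (nsphere k) (nsphere n) f \<and>
    (\<forall>x\<in>topspace (nsphere k). f (- x) = - f x \<and>
       (1 - real k / real (Suc n)) * sqrt (real (Suc n)) \<le> (\<Sum>i<Suc n. \<bar>f x i\<bar>))"
proof -
  define N where "N = Suc n"
  define g where "g = (\<lambda>x j. step_average N (Suc k) j x)"
  define R where "R = (\<lambda>x. L2_set (g x) {..<N})"
  define f where "f = (\<lambda>x i. if i < N then g x i / R x else 0)"
  have l1: "real N - real k \<le> (\<Sum>j<N. \<bar>g x j\<bar>)" if "x \<in> topspace (nsphere k)" for x
    unfolding g_def using that by (rule sum_abs_step_average_ge)
  \<comment> \<open>Since \<open>k < N\<close>, the l1 bound is positive, so the vector never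
    vanishes and can be normalised continuously.\<close>
  have Rpos: "R x > 0" if "x \<in> topspace (nsphere k)" for x
  proof -
    have "0 < real N - real k"
      using assms by (simp add: N_def)
    also have "\<dots> \<le> sqrt (real N) * R x"
      using l1[OF that] sum_abs_le_L2_set[of "g x" N] by (simp add: R_def)
    finally show ?thesis
      by (simp add: zero_less_mult_iff)
  qed
  have Rle: "R x \<le> sqrt (real N)" for x
  proof -
    have "R x \<le> L2_set (\<lambda>_. 1) {..<N}"
      unfolding R_def L2_set_def
      by (intro real_sqrt_le_mono sum_mono) (simp add: g_def abs_square_le_1 abs_step_average_le_1)
    then show ?thesis
      by (simp add: L2_set_constant)
  qed
  have norm: "L2_set (f x) {..<N} = 1" if "x \<in> topspace (nsphere k)" for x
  proof -
    have "L2_set (f x) {..<N} = L2_set (\<lambda>i. inverse (R x) * g x i) {..<N}"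
      by (rule L2_set_cong) (auto simp: f_def field_simps)
    also have "\<dots> = inverse (R x) * R x"
      unfolding R_def using Rpos[OF that] by (subst L2_set_right_distrib) auto
    finally show ?thesis
      using Rpos[OF that] by simp
  qed
  have cont_g: "continuous_map (nsphere k) euclideanreal (\<lambda>x. g x i)" for i
    using continuous_map_step_average[of k N "Suc k" i] by (simp add: g_def)
  have cont_R: "continuous_map (nsphere k) euclideanreal R"
    unfolding R_def L2_set_def by (intro continuous_intros cont_g) auto
  have "continuous_map (nsphere k) (Euclidean_space N) f"
    unfolding f_def continuous_map_componentwise_Euclidean_space
    using Rpos by (intro allI impI continuous_map_real_divide cont_g cont_R) force
  then have "continuous_map (nsphere k) (nsphere n) f"
    unfolding nsphere_def[of n] continuous_map_in_subtopology
    using norm by (auto simp: N_def L2_set_def lessThan_Suc_atMost)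
  moreover have "f (- x) = - f x" for x
    by (auto simp: f_def R_def g_def L2_set_def step_average_minus)
  moreover have "(1 - real k / real N) * sqrt (real N) \<le> (\<Sum>i<N. \<bar>f x i\<bar>)"
    if x: "x \<in> topspace (nsphere k)" for x
  proof -
    have "(1 - real k / real N) * sqrt (real N) = (real N - real k) / sqrt (real N)"
      using real_sqrt_mult_self[of "real N"]
      by (simp add: N_def field_simps del: real_sqrt_mult_self)
    also have "\<dots> \<le> (real N - real k) / R x"
      using Rle Rpos[OF x] assms by (intro divide_left_mono) (auto simp: N_def)
    also have "\<dots> \<le> (\<Sum>j<N. \<bar>g x j\<bar>) / R x"
      using l1[OF x] Rpos[OF x] by (simp add: divide_right_mono)
    also have "\<dots> = (\<Sum>i<N. \<bar>f x i\<bar>)"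
      using Rpos[OF x] by (simp add: f_def sum_divide_distrib)
    finally show ?thesis .
  qed
  ultimately show ?thesis
    unfolding N_def by blast
qed

subsection \<open>Great circles\<close>

lemma subspace_normalize:
  fixes a :: "nat \<Rightarrow> real"
  assumes V: "subspace V" "V \<subseteq> topspace (Euclidean_space (Suc n))" and a: "a \<in> V" "a \<noteq> 0"
  obtains c where "c \<noteq> 0" "c *\<^sub>R a \<in> V \<inter> topspace (nsphere n)"
proof
  define r where "r = L2_set a {..<Suc n}"
  have 0: "a i = 0" if "i > n" for i
    using V(2) a(1) that by (auto simp: topspace_Euclidean_space)
  have "r \<noteq> 0"
  proof
    assume "r = 0"
    then have "\<forall>i<Suc n. a i = 0"
      by (simp add: r_def L2_set_eq_0_iff)
    with 0 have "a i = 0" for i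
      by (cases "i > n") auto
    with a(2) show False
      by (auto simp: fun_eq_iff)
  qed
  then have "r > 0"
    using L2_set_nonneg[of a "{..<Suc n}"] by (simp add: r_def less_le)
  then show "inverse r \<noteq> 0"
    by simp
  have "L2_set (inverse r *\<^sub>R a) {..<Suc n} = inverse r * r"
    unfolding r_def using \<open>r > 0\<close> by (subst L2_set_right_distrib) (auto simp: r_def scaleR_fun_def)
  then have "inverse r *\<^sub>R a \<in> topspace (nsphere n)"
    using 0 \<open>r > 0\<close> by (simp add: in_nsphere_iff scaleR_fun_def)
  then show "inverse r *\<^sub>R a \<in> V \<inter> topspace (nsphere n)"
    using V(1) a(1) by (simp add: subspace_scale)
qed

lemma great_circle_orthonormal_basis:
  assumes V: "subspace V" "V \<subseteq> topspace (Euclidean_space (Suc n))" "dim V = 2"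
  obtains u w where "u \<in> V \<inter> topspace (nsphere n)" "w \<in> V \<inter> topspace (nsphere n)"
    "(\<Sum>i<Suc n. u i * w i) = 0"
proof -
  obtain B where B: "B \<subseteq> V" "independent B" "card B = 2"
    using real_vector.basis_exists[of V] V(3) by metis
  then obtain a b where ab: "B = {a, b}" "a \<noteq> b"
    by (meson card_2_iff)
  have "b \<notin> span {a}" "a \<noteq> 0"
    using B(2) ab real_vector.independent_insert[of b "{a}"] real_vector.dependent_zero[of B]
    by (auto simp: insert_commute)
  have aV: "a \<in> V" and bV: "b \<in> V"
    using B(1) ab by auto
  obtain c where c: "c \<noteq> 0" "c *\<^sub>R a \<in> V \<inter> topspace (nsphere n)"
    using subspace_normalize[OF V(1,2) aV \<open>a \<noteq> 0\<close>] .
  define u where "u = c *\<^sub>R a"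
  define p where "p = (\<Sum>i<Suc n. u i * b i)"
  \<comment> \<open>One Gram-Schmidt step; independence of \<open>a\<close> and \<open>b\<close>
    keeps \<open>w\<close> nonzero.\<close>
  define w where "w = b - p *\<^sub>R u"
  have u1: "(\<Sum>i<Suc n. u i * u i) = 1"
    using c(2) by (simp add: in_nsphere_iff u_def L2_set_def power2_eq_square)
  have "(\<Sum>i<Suc n. u i * w i) = (\<Sum>i<Suc n. u i * b i) - p * (\<Sum>i<Suc n. u i * u i)"
    by (simp only: w_def fun_diff_def scaleR_fun_def sum_distrib_left right_diff_distrib
        sum_subtractf real_scaleR_def mult.left_commute)
  then have uw: "(\<Sum>i<Suc n. u i * w i) = 0"
    using u1 by (simp add: p_def)
  have "w \<in> V"
    unfolding w_def u_def using V(1) bV c(2) aV by (intro subspace_diff subspace_scale)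
  moreover have "w \<noteq> 0"
  proof
    assume "w = 0"
    then have "b = (p * c) *\<^sub>R a"
      by (simp add: w_def u_def)
    with \<open>b \<notin> span {a}\<close> show False
      by (simp add: span_scale span_base)
  qed
  ultimately obtain d where d: "d *\<^sub>R w \<in> V \<inter> topspace (nsphere n)"
    using subspace_normalize[OF V(1,2)] by metis
  have "(\<Sum>i<Suc n. u i * (d *\<^sub>R w) i) = d * (\<Sum>i<Suc n. u i * w i)"
    by (simp only: sum_distrib_left scaleR_fun_def real_scaleR_def mult.left_commute)
  then show thesis
    using that[of u "d *\<^sub>R w"] c(2) d uw by (simp add: u_def)
qed

text \<open>Since |x + y| + |x - y| = 2 max(|x|, |y|), the left side is the larger of 2|a| and |a| +
  sqrt 3 |b|. The second is bounded by Cauchy-Schwarz against (1, sqrt 3), a vector of length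
  2.\<close>

lemma abs_hexagon_le:
  fixes a b :: real
  shows "\<bar>a\<bar> + \<bar>1/2 * a + sqrt 3/2 * b\<bar> + \<bar>1/2 * a - sqrt 3/2 * b\<bar> \<le> 2 * sqrt (a\<^sup>2 + b\<^sup>2)"
proof -
  have "\<bar>a\<bar> + sqrt 3 * \<bar>b\<bar> \<le> sqrt ((2 * sqrt (a\<^sup>2 + b\<^sup>2))\<^sup>2)"
  proof (rule real_le_rsqrt)
    \<comment> \<open>This square is exactly the difference of the two sides of the goal.\<close>
    have "0 \<le> (sqrt 3 * \<bar>a\<bar> - \<bar>b\<bar>)\<^sup>2"
      by simp
    then show "(\<bar>a\<bar> + sqrt 3 * \<bar>b\<bar>)\<^sup>2 \<le> (2 * sqrt (a\<^sup>2 + b\<^sup>2))\<^sup>2"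
      by (simp add: power2_sum power2_diff power_mult_distrib algebra_simps)
  qed
  then have 1: "\<bar>a\<bar> + \<bar>sqrt 3 * b\<bar> \<le> 2 * sqrt (a\<^sup>2 + b\<^sup>2)"
    unfolding real_sqrt_abs by (simp add: abs_mult)
  have 2: "\<bar>a\<bar> \<le> sqrt (a\<^sup>2 + b\<^sup>2)"
    by (rule real_sqrt_ge_abs1)
  show ?thesis
    using 1 2 by linarith
qed

text \<open>The planar inequality is applied to each pair \<open>(u i, w i)\<close>. Cauchy-Schwarz
  then bounds the sum of the roots, whose squares add up to 2 by orthonormality.\<close>

lemma great_circle_small_l1_norms:
  assumes V: "subspace V" "V \<subseteq> topspace (Euclidean_space (Suc n))" "dim V = 2"
  obtains v1 v2 v3 where "{v1, v2, v3} \<subseteq> V \<inter> topspace (nsphere n)"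
    "(\<Sum>i<Suc n. \<bar>v1 i\<bar>) + (\<Sum>i<Suc n. \<bar>v2 i\<bar>) + (\<Sum>i<Suc n. \<bar>v3 i\<bar>)
      \<le> 2 * sqrt 2 * sqrt (real (Suc n))"
proof -
  define I where "I = {..<Suc n}"
  obtain u w where u: "u \<in> V \<inter> topspace (nsphere n)" and w: "w \<in> V \<inter> topspace (nsphere n)"
    and uw: "(\<Sum>i\<in>I. u i * w i) = 0"
    using great_circle_orthonormal_basis[OF V] unfolding I_def by metis
  have u1: "(\<Sum>i\<in>I. (u i)\<^sup>2) = 1" and w1: "(\<Sum>i\<in>I. (w i)\<^sup>2) = 1"
    using u w by (auto simp: in_nsphere_iff L2_set_def I_def)
  define v where "v = (\<lambda>s t. s *\<^sub>R u + t *\<^sub>R w)"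
  have v_apply: "v s t i = s * u i + t * w i" for s t i
    by (simp add: v_def scaleR_fun_def)
  have v_in: "v s t \<in> V \<inter> topspace (nsphere n)" if "s\<^sup>2 + t\<^sup>2 = 1" for s t
  proof -
    have "(\<Sum>i\<in>I. (v s t i)\<^sup>2)
        = (\<Sum>i\<in>I. s\<^sup>2 * (u i)\<^sup>2 + t\<^sup>2 * (w i)\<^sup>2 + 2 * s * t * (u i * w i))"
      by (rule sum.cong) (simp_all add: v_apply power2_sum power_mult_distrib)
    also have "\<dots> = s\<^sup>2 * 1 + t\<^sup>2 * 1 + 2 * s * t * 0"
      by (simp only: sum.distrib sum_distrib_left[symmetric] u1 w1 uw)
    finally have "L2_set (v s t) {..<Suc n} = 1"
      using that by (simp add: L2_set_def I_def)
    moreover have "v s t \<in> V"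
      unfolding v_def using V(1) u w by (auto intro: subspace_add subspace_scale)
    ultimately show ?thesis
      using u w by (auto simp: in_nsphere_iff v_apply)
  qed
  have hex: "{v 1 0, v (1/2) (sqrt 3/2), v (1/2) (- (sqrt 3/2))} \<subseteq> V \<inter> topspace (nsphere n)"
    using v_in[of 1 0] v_in[of "1/2" "sqrt 3/2"] v_in[of "1/2" "- (sqrt 3/2)"]
    by (simp add: power_divide)
  have "(\<Sum>i\<in>I. \<bar>v 1 0 i\<bar>) + (\<Sum>i\<in>I. \<bar>v (1/2) (sqrt 3/2) i\<bar>) + (\<Sum>i\<in>I. \<bar>v (1/2) (- (sqrt 3/2)) i\<bar>)
      \<le> (\<Sum>i\<in>I. 2 * \<bar>sqrt ((u i)\<^sup>2 + (w i)\<^sup>2)\<bar>)"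
    unfolding sum.distrib[symmetric]
    by (rule sum_mono) (use abs_hexagon_le in \<open>simp add: v_apply\<close>)
  also have "\<dots> = 2 * (\<Sum>i\<in>I. \<bar>sqrt ((u i)\<^sup>2 + (w i)\<^sup>2)\<bar>)"
    by (simp only: sum_distrib_left)
  also have "\<dots> \<le> 2 * (sqrt (real (Suc n)) * L2_set (\<lambda>i. sqrt ((u i)\<^sup>2 + (w i)\<^sup>2)) I)"
    unfolding I_def by (rule mult_left_mono[OF sum_abs_le_L2_set]) simp
  also have "L2_set (\<lambda>i. sqrt ((u i)\<^sup>2 + (w i)\<^sup>2)) I = sqrt 2"
    by (simp add: L2_set_def sum.distrib u1 w1)
  finally show thesis
    using that[OF hex] by (simp add: I_def algebra_simps del: sum.lessThan_Suc)
qed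

section \<open>Points near the image, and the choice of constants\<close>

lemma expansion_l1_norm_ge:
  assumes v: "v \<in> expansion n \<epsilon> X" and "\<epsilon> < \<delta>"
    and X: "\<And>a. a \<in> X \<Longrightarrow> c * sqrt (real (Suc n)) \<le> (\<Sum>i<Suc n. \<bar>a i\<bar>)"
  shows "(c - \<delta>) * sqrt (real (Suc n)) \<le> (\<Sum>i<Suc n. \<bar>v i\<bar>)"
proof -
  \<comment> \<open>The infimum need not be attained; the slack between \<epsilon> and \<delta>
    yields an actual point of \<open>X\<close> within \<delta>.\<close>
  have "X \<noteq> {}" "(INF a\<in>X. euclidean_dist (Suc n) v a) < \<delta>"
    using v \<open>\<epsilon> < \<delta>\<close> by (auto simp: expansion_def)
  then obtain a where a: "a \<in> X" "euclidean_dist (Suc n) v a < \<delta>"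
    using cInf_lessD[of "euclidean_dist (Suc n) v ` X"] by auto
  have "c * sqrt (real (Suc n)) \<le> (\<Sum>i<Suc n. \<bar>a i\<bar>)"
    using X a(1) .
  also have "\<dots> \<le> (\<Sum>i<Suc n. \<bar>v i\<bar> + \<bar>v i - a i\<bar>)"
    by (rule sum_mono) linarith
  also have "\<dots> = (\<Sum>i<Suc n. \<bar>v i\<bar>) + (\<Sum>i<Suc n. \<bar>v i - a i\<bar>)"
    by (rule sum.distrib)
  also have "(\<Sum>i<Suc n. \<bar>v i - a i\<bar>) \<le> sqrt (real (Suc n)) * euclidean_dist (Suc n) v a"
    unfolding euclidean_dist_def by (rule sum_abs_le_L2_set)
  also have "\<dots> \<le> sqrt (real (Suc n)) * \<delta>"
    using a(2) by (intro mult_left_mono) auto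
  finally show ?thesis
    by (simp add: algebra_simps del: sum.lessThan_Suc)
qed

theorem theorem1p5:
  shows "\<exists>\<alpha> \<epsilon> :: real. \<alpha> > 0 \<and> \<epsilon> > 0 \<and>
    (\<forall>n::nat. n \<ge> 1 \<longrightarrow>
      (\<exists>X. topological_subsphere (nat \<lfloor>\<alpha> * real n\<rfloor>) n X \<and>
           \<not> (\<exists>L. linear_subsphere 1 n L \<and> L \<subseteq> expansion n \<epsilon> X)))"
proof -
  \<comment> \<open>With 1/100 for both constants, k/N costs at most 1/100 of the l1 norm and the
    expansion, taken with \<delta> = 1/50, another 2/100. The remaining 97/100 exceeds (2 sqrt 2)/3,
    which is about 0.943.\<close>
  have "\<exists>X. topological_subsphere (nat \<lfloor>1/100 * real n\<rfloor>) n X \<and>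
      \<not> (\<exists>L. linear_subsphere 1 n L \<and> L \<subseteq> expansion n (1/100) X)" for n
  proof -
    define k where "k = nat \<lfloor>1/100 * real n\<rfloor>"
    have k: "real k \<le> 1/100 * real n"
      unfolding k_def by linarith
    then have "k \<le> n"
      by linarith
    then obtain f where f: "continuous_map (nsphere k) (nsphere n) f"
      "\<And>x. x \<in> topspace (nsphere k) \<Longrightarrow> f (- x) = - f x"
      "\<And>x. x \<in> topspace (nsphere k) \<Longrightarrow>
        (1 - real k / real (Suc n)) * sqrt (real (Suc n)) \<le> (\<Sum>i<Suc n. \<bar>f x i\<bar>)"
      using ex_odd_map_large_l1_norm by metis
    define X where "X = f ` topspace (nsphere k)"
    have "topological_subsphere k n X"
      using f(1,2) by (auto simp: topological_subsphere_def X_def)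
    moreover have False if L: "linear_subsphere 1 n L" "L \<subseteq> expansion n (1/100) X" for L
    proof -
      obtain V where V: "subspace V" "V \<subseteq> topspace (Euclidean_space (Suc n))" "dim V = 2"
        and LV: "L = V \<inter> topspace (nsphere n)"
        using L(1) unfolding linear_subsphere_def numeral_2_eq_2 One_nat_def by blast
      obtain v1 v2 v3 where v: "{v1, v2, v3} \<subseteq> L"
        and le: "(\<Sum>i<Suc n. \<bar>v1 i\<bar>) + (\<Sum>i<Suc n. \<bar>v2 i\<bar>) + (\<Sum>i<Suc n. \<bar>v3 i\<bar>)
          \<le> 2 * sqrt 2 * sqrt (real (Suc n))"
        using great_circle_small_l1_norms[OF V] LV by metis
      have "99/100 * sqrt (real (Suc n)) \<le> (\<Sum>i<Suc n. \<bar>a i\<bar>)" if "a \<in> X" for a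
      proof -
        have "99/100 \<le> 1 - real k / real (Suc n)"
          using k by (simp add: field_simps)
        then have "99/100 * sqrt (real (Suc n)) \<le> (1 - real k / real (Suc n)) * sqrt (real (Suc n))"
          by (rule mult_right_mono) simp
        also have "\<dots> \<le> (\<Sum>i<Suc n. \<bar>a i\<bar>)"
          using that f(3) by (auto simp: X_def simp del: sum.lessThan_Suc of_nat_Suc)
        finally show ?thesis .
      qed
      then have ge: "(99/100 - 1/50) * sqrt (real (Suc n)) \<le> (\<Sum>i<Suc n. \<bar>v i\<bar>)" if "v \<in> L" for v
        using that L(2) by (intro expansion_l1_norm_ge[where \<epsilon> = "1/100" and X = X]) auto
      \<comment> \<open>Three points, each with l1 norm at least 97/100 of
        \<open>sqrt (real (Suc n))\<close>.\<close>
      have "291/100 * sqrt (real (Suc n)) \<le> 2 * sqrt 2 * sqrt (real (Suc n))"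
        using ge[of v1] ge[of v2] ge[of v3] v le
        unfolding insert_subset left_diff_distrib by linarith
      then have "291/200 \<le> sqrt 2"
        by (simp del: of_nat_Suc)
      then have "(291/200)\<^sup>2 \<le> (2::real)"
        using real_le_lsqrt by (metis divide_nonneg_nonneg zero_le_numeral real_sqrt_le_iff real_sqrt_unique)
      then show False
        by (simp add: power2_eq_square)
    qed
    ultimately show ?thesis
      unfolding k_def by blast
  qed
  then show ?thesis
    by (intro exI[of _ "1/100"]) simp
qed

end
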